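(* Let $w=k_1k_2\cdots k_n$ ($n\ge1$, $k_1\in\{1,2,3\}$, $k_j\in\{0,1,2,3\}$ for $j\ge2$) be a tree word, and let $w'=k_1'k_2'\cdots k_n'$ be the tree word obtained from $w$ by applying the swap $1\leftrightarrow3$ (fixing $2$) to the first digit and the swaps $0\leftrightarrow3$, $1\leftrightarrow2$ to all the other digits. Then $w$ and $w'$ give identical trajectories on the regular pentagon billiard table: as unoriented closed paths, the short billiard trajectories associated to $w$ are the same as the short billiard trajectories associated to $w'$, and likewise for the long ones.
   Context: Let $\phi=(1+\sqrt5)/2$ and $\sigma_0=\begin{bmatrix}1&\phi\\0&1\end{bmatrix}$, $\sigma_1=\begin{bmatrix}\phi&\phi\\1&\phi\end{bmatrix}$, $\sigma_2=\begin{bmatrix}\phi&1\\\phi&\phi\end{bmatrix}$, $\sigma_3=\begin{bmatrix}1&0\\\phi&1\end{bmatrix}$, $P=\begin{bmatrix}1&\cos(\pi/5)\\0&\sin(\pi/5)\end{bmatrix}$. The tree word $k_1k_2\cdots k_n$ (with $k_1\ne0$) corresponds to the vector $\mathbf v=\sigma_{k_n}\cdots\sigma_{k_1}\begin{bmatrix}1\\0\end{bmatrix}$ (digits are listed in order of application). Let $Q$ be a regular pentagon centered at the origin with a horizontal side and diagonals of length $1$. The double pentagon is the translation surface obtained from $Q$ and $-Q$ by gluing each side of $Q$ by translation to the parallel side of $-Q$. For every tree word, $P\mathbf v$ is a periodic direction of the double pentagon; in this direction there are exactly two cylinders (maximal families of parallel periodic trajectories), a short one and a long one, with length ratio $\phi$.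 The necklace is the translation surface which is the unfolding of the billiard table $Q$: letting $D$ be the dihedral group of order 10 generated by the linear reflections $s_e$ in the directions of the sides $e$ of $Q$, it is made of the ten pentagons $gQ$, $g\in D$ (each equal to $Q$ or $-Q$), with side $ge$ of the copy $gQ$ glued by translation to the parallel side of the copy $gs_eQ$. It is a 5-fold cover of the double pentagon, and folding ($gx\mapsto x$) maps necklace trajectories to billiard trajectories in $Q$. The short (long) billiard trajectories associated to a tree word are the foldings of the lifts to the necklace of the periodic trajectories in the short (long) cylinder of the double pentagon in direction $P\mathbf v$. *)

theory Defs
  imports "HOL-Analysis.Analysis"
begin

type_synonym plane = "real^2"

section \<open>Tree words\<close>

definition golden :: real where
  "golden = (1 + sqrt 5) / 2"

definition sigma :: "nat \<Rightarrow> real^2^2" where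
  "sigma k =
    [vector [vector [1, golden], vector [0, 1]],
     vector [vector [golden, golden], vector [1, golden]],
     vector [vector [golden, 1], vector [golden, golden]],
     vector [vector [1, 0], vector [golden, 1]]] ! k"

definition Pmat :: "real^2^2" where
  "Pmat = vector [vector [1, cos (pi / 5)], vector [0, sin (pi / 5)]]"

definition tree_word :: "nat list \<Rightarrow> bool" where
  "tree_word w \<longleftrightarrow> w \<noteq> [] \<and> set w \<subseteq> {0, 1, 2, 3} \<and> hd w \<noteq> 0"

text \<open>The first digit of the word is applied first.\<close>

definition tree_vector :: "nat list \<Rightarrow> plane" where
  "tree_vector w = foldl (\<lambda>v k. sigma k *v v) (vector [1, 0]) w"

text \<open>Unit vector in the direction \<open>P v\<close>; trajectories below have unit speed.\<close>

definition tree_direction :: "nat list \<Rightarrow> plane" where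
  "tree_direction w = sgn (Pmat *v tree_vector w)"

definition swapped_word :: "nat list \<Rightarrow> nat list" where
  "swapped_word w =
    (id(1 := 3, 3 := 1)) (hd w) # map (id(0 := 3, 3 := 0, 1 := 2, 2 := 1)) (tl w)"

section \<open>Translation surfaces tiled by pentagons\<close>

text \<open>
  The tile labelled \<open>a\<close> is the convex hull of its vertices \<open>vertex a 0, \<dots>, vertex a 4\<close>, which
  are listed cyclically with \<open>vertex a 5 = vertex a 0\<close>. Its \<open>j\<close>-th side (\<open>j < 5\<close>) is glued by
  translation to the parallel side of the tile labelled \<open>neighbour a j\<close>.
\<close>

record 'l tiled_surface =
  labels :: "'l set"
  vertex :: "'l \<Rightarrow> nat \<Rightarrow> plane"
  neighbour :: "'l \<Rightarrow> nat \<Rightarrow> 'l"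

definition side :: "(nat \<Rightarrow> plane) \<Rightarrow> nat \<Rightarrow> plane set" where
  "side q j = closed_segment (q j) (q (Suc j))"

definition polygon :: "(nat \<Rightarrow> plane) \<Rightarrow> plane set" where
  "polygon q = convex hull (q ` {..<5})"

text \<open>
  The vertices become the cone points of the surface. No straight trajectory may pass through
  them, so they are removed: a point of the surface is an equivalence class of pairs (label,
  point of the tile other than a vertex). On such pairs \<open>identified\<close> is an equivalence relation
  for the two surfaces below.
\<close>

definition tile :: "('l, 'm) tiled_surface_scheme \<Rightarrow> 'l \<Rightarrow> plane set" where
  "tile S a = polygon (vertex S a) - vertex S a ` {..<5}"

definition tile_points :: "('l, 'm) tiled_surface_scheme \<Rightarrow> ('l \<times> plane) set" where
  "tile_points S = Sigma (labels S) (tile S)"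

definition identified ::
    "('l, 'm) tiled_surface_scheme \<Rightarrow> (('l \<times> plane) \<times> ('l \<times> plane)) set" where
  "identified S = {((a, x), (b, y)). (a, x) \<in> tile_points S \<and> (b, y) \<in> tile_points S \<and>
     ((a, x) = (b, y) \<or>
      (\<exists>j<5. \<exists>k<5. \<exists>\<tau>. b = neighbour S a j \<and> side (vertex S b) k = (+) \<tau> ` side (vertex S a) j \<and>
         x \<in> side (vertex S a) j \<and> y = \<tau> + x))}"

definition surface_points :: "('l, 'm) tiled_surface_scheme \<Rightarrow> ('l \<times> plane) set set" where
  "surface_points S = tile_points S // identified S"

text \<open>The quotient topology of the disjoint union of the tiles.\<close>

definition surface_topology ::
    "('l, 'm) tiled_surface_scheme \<Rightarrow> ('l \<times> plane) set topology" where
  "surface_topology S = topology (\<lambda>U. U \<subseteq> surface_points S \<and>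
     (\<forall>a\<in>labels S. openin (top_of_set (tile S a)) {x \<in> tile S a. identified S `` {(a, x)} \<in> U}))"

lemma openin_surface_topology:
  "openin (surface_topology S) U \<longleftrightarrow> U \<subseteq> surface_points S \<and>
     (\<forall>a\<in>labels S. openin (top_of_set (tile S a)) {x \<in> tile S a. identified S `` {(a, x)} \<in> U})"
proof -
  let ?V = "\<lambda>a U. {x \<in> tile S a. identified S `` {(a, x)} \<in> U}"
  have "?V a (U \<inter> W) = ?V a U \<inter> ?V a W" for a U W by auto
  moreover have "?V a (\<Union>K) = (\<Union>U\<in>K. ?V a U)" for a K by auto
  ultimately have "istopology (\<lambda>U. U \<subseteq> surface_points S \<and>
      (\<forall>a\<in>labels S. openin (top_of_set (tile S a)) (?V a U)))"
    unfolding istopology_def by (auto intro: openin_Int openin_Union)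
  then show ?thesis
    unfolding surface_topology_def by (simp add: topology_inverse')
qed

section \<open>Trajectories and cylinders\<close>

text \<open>
  A trajectory in direction \<open>u\<close> is locally \<open>s \<mapsto> x + (s - t) u\<close> in a tile. On a side the two
  representatives of the point take care of the two sides of the curve, which is why the
  representative \<open>(a, x)\<close> is chosen after \<open>s\<close>.
\<close>

definition trajectory :: "('l, 'm) tiled_surface_scheme \<Rightarrow> plane \<Rightarrow>
    (real \<Rightarrow> ('l \<times> plane) set) \<Rightarrow> bool" where
  "trajectory S u \<gamma> \<longleftrightarrow> (\<forall>t. \<gamma> t \<in> surface_points S \<and>
     (\<exists>\<epsilon>>0. \<forall>s. \<bar>s - t\<bar> < \<epsilon> \<longrightarrow> (\<exists>(a, x)\<in>\<gamma> t. (a, x + (s - t) *\<^sub>R u) \<in> \<gamma> s)))"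

definition periods :: "(real \<Rightarrow> 'p) \<Rightarrow> real set" where
  "periods \<gamma> = {T. T > 0 \<and> (\<forall>t. \<gamma> (t + T) = \<gamma> t)}"

definition periodic_trajectories ::
    "('l, 'm) tiled_surface_scheme \<Rightarrow> plane \<Rightarrow> (real \<Rightarrow> ('l \<times> plane) set) set" where
  "periodic_trajectories S u = {\<gamma>. trajectory S u \<gamma> \<and> periods \<gamma> \<noteq> {}}"

text \<open>
  A cylinder, i.e. a maximal (connected) family of parallel periodic trajectories, is represented
  by the set of points these trajectories cover.
\<close>

definition cylinders ::
    "('l, 'm) tiled_surface_scheme \<Rightarrow> plane \<Rightarrow> ('l \<times> plane) set set set" where
  "cylinders S u = connected_components_of
     (subtopology (surface_topology S) (\<Union>\<gamma>\<in>periodic_trajectories S u. range \<gamma>))"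

definition trajectories_in :: "('l, 'm) tiled_surface_scheme \<Rightarrow> plane \<Rightarrow>
    ('l \<times> plane) set set \<Rightarrow> (real \<Rightarrow> ('l \<times> plane) set) set" where
  "trajectories_in S u C = {\<gamma> \<in> periodic_trajectories S u. range \<gamma> \<subseteq> C}"

text \<open>The common length (least period, for unit \<open>u\<close>) of the trajectories in the cylinder.\<close>

definition cylinder_length ::
    "('l, 'm) tiled_surface_scheme \<Rightarrow> plane \<Rightarrow> ('l \<times> plane) set set \<Rightarrow> real" where
  "cylinder_length S u C = (THE L. \<forall>\<gamma>\<in>trajectories_in S u C. L = Inf (periods \<gamma>))"

definition short_cylinder ::
    "('l, 'm) tiled_surface_scheme \<Rightarrow> plane \<Rightarrow> ('l \<times> plane) set set \<Rightarrow> bool" where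
  "short_cylinder S u C \<longleftrightarrow> C \<in> cylinders S u \<and>
     (\<forall>C'\<in>cylinders S u. C' \<noteq> C \<longrightarrow> cylinder_length S u C < cylinder_length S u C')"

definition long_cylinder ::
    "('l, 'm) tiled_surface_scheme \<Rightarrow> plane \<Rightarrow> ('l \<times> plane) set set \<Rightarrow> bool" where
  "long_cylinder S u C \<longleftrightarrow> C \<in> cylinders S u \<and>
     (\<forall>C'\<in>cylinders S u. C' \<noteq> C \<longrightarrow> cylinder_length S u C' < cylinder_length S u C)"

section \<open>The double pentagon and the necklace\<close>

text \<open>The pentagon is given by its vertices \<open>q 0, \<dots>, q 4\<close>; the formula makes \<open>q\<close> 5-periodic.\<close>

definition regular_pentagon_at_origin :: "(nat \<Rightarrow> plane) \<Rightarrow> bool" where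
  "regular_pentagon_at_origin q \<longleftrightarrow> (\<exists>r>0. \<exists>\<alpha>. \<forall>j.
     q j = vector [r * cos (\<alpha> + 2 * pi * real j / 5), r * sin (\<alpha> + 2 * pi * real j / 5)])"

text \<open>The label \<open>1\<close> stands for \<open>Q\<close> and the label \<open>-1\<close> for \<open>-Q\<close>.\<close>

definition double_pentagon :: "(nat \<Rightarrow> plane) \<Rightarrow> real tiled_surface" where
  "double_pentagon q = \<lparr>labels = {1, -1}, vertex = (\<lambda>\<delta> j. \<delta> *\<^sub>R q j), neighbour = (\<lambda>\<delta> j. - \<delta>)\<rparr>"

text \<open>The linear reflection in the direction of the \<open>j\<close>-th side.\<close>

definition side_reflection :: "(nat \<Rightarrow> plane) \<Rightarrow> nat \<Rightarrow> plane \<Rightarrow> plane" where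
  "side_reflection q j x =
    (let e = q (Suc j) - q j in (2 * (x \<bullet> e) / (e \<bullet> e)) *\<^sub>R e - x)"

text \<open>The generators are involutions, so their products already form a group.\<close>

inductive_set dihedral :: "(nat \<Rightarrow> plane) \<Rightarrow> (plane \<Rightarrow> plane) set" for q where
  id: "id \<in> dihedral q"
| step: "g \<in> dihedral q \<Longrightarrow> j < 5 \<Longrightarrow> g \<circ> side_reflection q j \<in> dihedral q"

definition necklace :: "(nat \<Rightarrow> plane) \<Rightarrow> (plane \<Rightarrow> plane) tiled_surface" where
  "necklace q = \<lparr>labels = dihedral q, vertex = (\<lambda>g j. g (q j)),
     neighbour = (\<lambda>g j. g \<circ> side_reflection q j)\<rparr>"

text \<open>
  The covering of the double pentagon by the necklace: the copy \<open>g Q\<close> is mapped identically to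
  whichever of \<open>Q\<close> and \<open>-Q\<close> it equals.
\<close>

definition covering ::
    "(nat \<Rightarrow> plane) \<Rightarrow> ((plane \<Rightarrow> plane) \<times> plane) set \<Rightarrow> (real \<times> plane) set" where
  "covering q p = {(\<delta>, x). \<delta> \<in> {1, -1} \<and>
     (\<exists>g. (g, x) \<in> p \<and> g ` polygon q = (*\<^sub>R) \<delta> ` polygon q)}"

definition folding :: "((plane \<Rightarrow> plane) \<times> plane) set \<Rightarrow> plane" where
  "folding p = (THE x. \<exists>g. (g, g x) \<in> p)"

definition lifts :: "(nat \<Rightarrow> plane) \<Rightarrow> plane \<Rightarrow> (real \<Rightarrow> (real \<times> plane) set) \<Rightarrow>
    (real \<Rightarrow> ((plane \<Rightarrow> plane) \<times> plane) set) set" where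
  "lifts q u \<gamma> = {\<eta>. trajectory (necklace q) u \<eta> \<and> (\<forall>t. covering q (\<eta> t) = \<gamma> t)}"

section \<open>Billiard trajectories\<close>

text \<open>
  A closed path is given as a periodic map on the real line, parametrized by arc length. The
  unoriented path is its class under change of base point and of orientation.
\<close>

definition unoriented_path :: "(real \<Rightarrow> 'p) \<Rightarrow> (real \<Rightarrow> 'p) set" where
  "unoriented_path \<beta> = (\<Union>c. {\<lambda>t. \<beta> (c + t), \<lambda>t. \<beta> (c - t)})"

definition short_billiard_trajectories ::
    "(nat \<Rightarrow> plane) \<Rightarrow> nat list \<Rightarrow> (real \<Rightarrow> plane) set set" where
  "short_billiard_trajectories q w = {unoriented_path (\<lambda>t. folding (\<eta> t)) | \<eta> \<gamma> C.
     short_cylinder (double_pentagon q) (tree_direction w) C \<and>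
     \<gamma> \<in> trajectories_in (double_pentagon q) (tree_direction w) C \<and>
     \<eta> \<in> lifts q (tree_direction w) \<gamma>}"

definition long_billiard_trajectories ::
    "(nat \<Rightarrow> plane) \<Rightarrow> nat list \<Rightarrow> (real \<Rightarrow> plane) set set" where
  "long_billiard_trajectories q w = {unoriented_path (\<lambda>t. folding (\<eta> t)) | \<eta> \<gamma> C.
     long_cylinder (double_pentagon q) (tree_direction w) C \<and>
     \<gamma> \<in> trajectories_in (double_pentagon q) (tree_direction w) C \<and>
     \<eta> \<in> lifts q (tree_direction w) \<gamma>}"

end

theory Submission
  imports Defs
begin

text \<open>
  Conjugation by the coordinate swap exchanges \<open>\<sigma>\<^sub>0\<close> with \<open>\<sigma>\<^sub>3\<close> and \<open>\<sigma>\<^sub>1\<close> with \<open>\<sigma>\<^sub>2\<close>, so the vectors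
  of the two words differ by that swap. In the coordinates given by \<open>P\<close> the swap is the orthogonal
  reflection exchanging the directions \<open>0\<close> and \<open>\<pi>/5\<close>, which is \<open>-s\<close> for the linear reflection \<open>s\<close>
  in one of the sides of \<open>Q\<close>. Now \<open>s\<close> acts on the double pentagon (exchanging \<open>Q\<close> and \<open>-Q\<close>) and on
  the necklace (mapping the copy \<open>gQ\<close> to \<open>sgQ\<close>) by isometries which commute with the covering, and
  it leaves foldings unchanged. The sign only reverses the orientation of the trajectories.
\<close>

section \<open>Isometric involutions of tiled surfaces\<close>

text \<open>A reflection reverses the cyclic order of vertices, so vertices are compared as sets
  only, and a side may change its index from \<open>j\<close> to some \<open>k\<close>.\<close>

locale surface_involution =
  fixes S :: "('l, 'm) tiled_surface_scheme" and \<tau> :: "'l \<Rightarrow> 'l" and h :: "plane \<Rightarrow> plane"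
  assumes label_involution: "\<tau> (\<tau> a) = a"
    and label_closed: "a \<in> labels S \<Longrightarrow> \<tau> a \<in> labels S"
    and linear_h: "linear h"
    and h_involution: "h (h x) = x"
    and vertices: "a \<in> labels S \<Longrightarrow> vertex S (\<tau> a) ` {..<5} = h ` vertex S a ` {..<5}"
    and sides: "a \<in> labels S \<Longrightarrow> j < 5 \<Longrightarrow>
      \<exists>k<5. side (vertex S (\<tau> a)) k = h ` side (vertex S a) j \<and> neighbour S (\<tau> a) k = \<tau> (neighbour S a j)"
begin

definition flip :: "('l \<times> plane) set \<Rightarrow> ('l \<times> plane) set" where
  "flip p = map_prod \<tau> h ` p"

text \<open>Time runs backwards because the directions of the two words are related by
  \<open>- h\<close> rather than by \<open>h\<close>.\<close>

definition reverse :: "(real \<Rightarrow> ('l \<times> plane) set) \<Rightarrow> real \<Rightarrow> ('l \<times> plane) set" where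
  "reverse \<gamma> t = flip (\<gamma> (- t))"

lemma flip_flip [simp]: "flip (flip p) = p"
  by (simp add: flip_def image_image map_prod_def case_prod_unfold label_involution h_involution)

lemma flip_image_flip [simp]: "flip ` flip ` C = C"
  by (simp add: image_image)

lemma flip_inject [simp]: "flip p = flip p' \<longleftrightarrow> p = p'"
  by (metis flip_flip)

lemma inj_flip: "inj flip"
  by (simp add: inj_def)

lemma mem_flip: "(a, x) \<in> flip p \<longleftrightarrow> (\<tau> a, h x) \<in> p"
  unfolding flip_def
  by (force simp: label_involution h_involution image_iff)

lemma reverse_reverse [simp]: "reverse (reverse \<gamma>) = \<gamma>"
  by (simp add: reverse_def fun_eq_iff)

lemma range_reverse: "range (reverse \<gamma>) = flip ` range \<gamma>"
proof -
  have "range (reverse \<gamma>) = (\<lambda>t. flip (\<gamma> t)) ` range uminus"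
    unfolding reverse_def by (simp only: image_image)
  then show ?thesis
    by (simp add: image_image)
qed

lemma tile_flip: "a \<in> labels S \<Longrightarrow> tile S (\<tau> a) = h ` tile S a"
proof -
  assume a: "a \<in> labels S"
  have "inj h"
    by (metis h_involution injI)
  then show ?thesis
    unfolding tile_def polygon_def vertices[OF a]
    by (simp add: convex_hull_linear_image[OF linear_h] image_set_diff)
qed

lemma tile_points_flip: "(\<tau> a, h x) \<in> tile_points S \<longleftrightarrow> (a, x) \<in> tile_points S"
proof -
  have *: "(\<tau> a, h x) \<in> tile_points S" if "(a, x) \<in> tile_points S" for a x
    using that by (auto simp: tile_points_def label_closed tile_flip)
  show ?thesis
    \<comment> \<open>Applied to the flipped pair, the implication yields its own converse, since
      both maps are involutions. The same device recurs below.\<close>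
    using *[of a x] *[of "\<tau> a" "h x"] by (auto simp: label_involution h_involution)
qed

text \<open>By linearity, \<open>h\<close> conjugates the gluing translation by \<open>v\<close>
  into the translation by \<open>h v\<close>, and it carries glued sides to glued sides.\<close>

lemma identified_flip:
  "((\<tau> a, h x), (\<tau> b, h y)) \<in> identified S \<longleftrightarrow> ((a, x), (b, y)) \<in> identified S"
proof -
  have *: "((\<tau> a, h x), (\<tau> b, h y)) \<in> identified S"
    if "((a, x), (b, y)) \<in> identified S" for a x b y
  proof -
    have ax: "(a, x) \<in> tile_points S" and bY: "(b, y) \<in> tile_points S"
      and cases: "(a, x) = (b, y) \<or>
      (\<exists>j<5. \<exists>k<5. \<exists>v. b = neighbour S a j \<and> side (vertex S b) k = (+) v ` side (vertex S a) j \<and>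
         x \<in> side (vertex S a) j \<and> y = v + x)"
      using that by (auto simp: identified_def)
    have la: "a \<in> labels S" and lb: "b \<in> labels S"
      using ax bY by (auto simp: tile_points_def)
    from cases show ?thesis
    proof
      assume "(a, x) = (b, y)"
      then show ?thesis
        using ax by (auto simp: identified_def tile_points_flip)
    next
      assume "\<exists>j<5. \<exists>k<5. \<exists>v. b = neighbour S a j \<and>
        side (vertex S b) k = (+) v ` side (vertex S a) j \<and>
        x \<in> side (vertex S a) j \<and> y = v + x"
      then obtain j k v where j: "j < 5" and k: "k < 5" and b: "b = neighbour S a j"
        and s: "side (vertex S b) k = (+) v ` side (vertex S a) j"
        and x: "x \<in> side (vertex S a) j" and y: "y = v + x"
        by blast
      obtain j' where j': "j' < 5" "side (vertex S (\<tau> a)) j' = h ` side (vertex S a) j"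
        "neighbour S (\<tau> a) j' = \<tau> (neighbour S a j)"
        using sides[OF la j] by blast
      obtain k' where k': "k' < 5" "side (vertex S (\<tau> b)) k' = h ` side (vertex S b) k"
        using sides[OF lb k] by blast
      have "side (vertex S (\<tau> b)) k' = (+) (h v) ` side (vertex S (\<tau> a)) j'"
        unfolding k' j' s by (auto simp: image_image linear_add[OF linear_h])
      moreover have "h x \<in> side (vertex S (\<tau> a)) j'"
        using x j' by auto
      moreover have "h y = h v + h x"
        by (simp add: y linear_add[OF linear_h])
      moreover have "\<tau> b = neighbour S (\<tau> a) j'"
        using b j' by simp
      moreover have "(\<tau> a, h x) \<in> tile_points S" "(\<tau> b, h y) \<in> tile_points S"
        using ax bY by (auto simp: tile_points_flip)
      ultimately show ?thesis
        unfolding identified_def using j' k' by blast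
    qed
  qed
  show ?thesis
    using *[of a x b y] *[of "\<tau> a" "h x" "\<tau> b" "h y"]
    by (auto simp: label_involution h_involution)
qed

lemma flip_class: "flip (identified S `` {(a, x)}) = identified S `` {(\<tau> a, h x)}"
proof (rule set_eqI, clarify)
  fix b y
  show "(b, y) \<in> flip (identified S `` {(a, x)}) \<longleftrightarrow> (b, y) \<in> identified S `` {(\<tau> a, h x)}"
    using identified_flip[of a x "\<tau> b" "h y"] by (simp add: mem_flip label_involution h_involution)
qed

lemma flip_surface_points: "flip p \<in> surface_points S \<longleftrightarrow> p \<in> surface_points S"
proof -
  have *: "flip p \<in> surface_points S" if p: "p \<in> surface_points S" for p
  proof -
    obtain a x where "(a, x) \<in> tile_points S" "p = identified S `` {(a, x)}"
      using p by (auto simp: surface_points_def elim!: quotientE)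
    then show ?thesis
      unfolding surface_points_def
      by (metis flip_class quotientI tile_points_flip)
  qed
  show ?thesis
    using *[of p] *[of "flip p"] by auto
qed

section \<open>The involution as a homeomorphism\<close>

lemma topspace_surface_topology: "topspace (surface_topology S) = surface_points S"
proof
  show "topspace (surface_topology S) \<subseteq> surface_points S"
    by (metis openin_surface_topology openin_topspace)
  have "{x \<in> tile S a. identified S `` {(a, x)} \<in> surface_points S} = tile S a" if "a \<in> labels S" for a
    using that by (auto simp: surface_points_def tile_points_def intro: quotientI)
  then have "openin (surface_topology S) (surface_points S)"
    by (simp add: openin_surface_topology)
  then show "surface_points S \<subseteq> topspace (surface_topology S)"
    by (rule openin_subset)
qed

text \<open>For an involution continuity is enough. It is checked tile by tile: the trace of the
  preimage of \<open>U\<close> on tile \<open>a\<close> is the preimage under \<open>h\<close> of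
  the trace of \<open>U\<close> on tile \<open>\<tau> a\<close>.\<close>

lemma homeomorphic_flip: "homeomorphic_map (surface_topology S) (surface_topology S) flip"
proof (rule homeomorphic_map_involution)
  show "continuous_map (surface_topology S) (surface_topology S) flip"
    unfolding continuous_map_def topspace_surface_topology
  proof (intro conjI allI impI)
    show "flip \<in> surface_points S \<rightarrow> surface_points S"
      by (simp add: flip_surface_points)
    fix U assume U: "openin (surface_topology S) U"
    have "openin (top_of_set (tile S a))
        {x \<in> tile S a. identified S `` {(a, x)} \<in> {p \<in> surface_points S. flip p \<in> U}}"
      if a: "a \<in> labels S" for a
    proof -
      let ?V = "{x \<in> tile S (\<tau> a). identified S `` {(\<tau> a, x)} \<in> U}"
      have "openin (top_of_set (tile S (\<tau> a))) ?V"
        using U a by (simp add: openin_surface_topology label_closed)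
      moreover have "continuous_on (tile S a) h"
        by (intro linear_continuous_on linear_conv_bounded_linear[THEN iffD1] linear_h)
      moreover have "h \<in> tile S a \<rightarrow> tile S (\<tau> a)"
        using a by (auto simp: tile_flip)
      ultimately have "openin (top_of_set (tile S a)) (tile S a \<inter> h -` ?V)"
        by (intro continuous_openin_preimage[of "tile S a" h "tile S (\<tau> a)" ?V])
      moreover have "tile S a \<inter> h -` ?V =
          {x \<in> tile S a. identified S `` {(a, x)} \<in> {p \<in> surface_points S. flip p \<in> U}}"
        using a by (auto simp: flip_class tile_flip surface_points_def tile_points_def intro: quotientI)
      ultimately show ?thesis
        by simp
    qed
    then show "openin (surface_topology S) {p \<in> surface_points S. flip p \<in> U}"
      by (simp add: openin_surface_topology)
  qed
qed simp

section \<open>Trajectories, periods and cylinders under the involution\<close>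

lemma trajectory_reverse: "trajectory S u \<gamma> \<Longrightarrow> trajectory S (- h u) (reverse \<gamma>)"
  unfolding trajectory_def
proof (intro allI conjI)
  fix t
  assume *: "\<forall>t. \<gamma> t \<in> surface_points S \<and>
     (\<exists>\<epsilon>>0. \<forall>s. \<bar>s - t\<bar> < \<epsilon> \<longrightarrow> (\<exists>(a, x)\<in>\<gamma> t. (a, x + (s - t) *\<^sub>R u) \<in> \<gamma> s))"
  then show "reverse \<gamma> t \<in> surface_points S"
    by (simp add: reverse_def flip_surface_points)
  from * obtain \<epsilon> where "\<epsilon> > 0"
    and e: "\<And>s. \<bar>s - - t\<bar> < \<epsilon> \<Longrightarrow> \<exists>(a, x)\<in>\<gamma> (- t). (a, x + (s - - t) *\<^sub>R u) \<in> \<gamma> s"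
    by blast
  have "\<exists>(a, x)\<in>reverse \<gamma> t. (a, x + (s - t) *\<^sub>R (- h u)) \<in> reverse \<gamma> s" if "\<bar>s - t\<bar> < \<epsilon>" for s
  proof -
    have "\<bar>- s - - t\<bar> < \<epsilon>"
      using that by linarith
    from e[OF this] obtain a x
      where "(a, x) \<in> \<gamma> (- t)" and "(a, x + (- s - - t) *\<^sub>R u) \<in> \<gamma> (- s)"
      by blast
    \<comment> \<open>The sign in the direction \<open>- h u\<close> is absorbed by the reversal of
      time.\<close>
    moreover have "h (h x + (s - t) *\<^sub>R (- h u)) = x + (- s - - t) *\<^sub>R u"
      by (simp add: linear_add[OF linear_h] linear_scale[OF linear_h] linear_diff[OF linear_h]
          h_involution algebra_simps)
    ultimately have "(\<tau> a, h x) \<in> reverse \<gamma> t \<and>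
        (\<tau> a, h x + (s - t) *\<^sub>R (- h u)) \<in> reverse \<gamma> s"
      by (simp only: reverse_def mem_flip label_involution h_involution)
    then show ?thesis
      by blast
  qed
  with \<open>\<epsilon> > 0\<close> show "\<exists>\<epsilon>>0. \<forall>s. \<bar>s - t\<bar> < \<epsilon> \<longrightarrow>
      (\<exists>(a, x)\<in>reverse \<gamma> t. (a, x + (s - t) *\<^sub>R (- h u)) \<in> reverse \<gamma> s)"
    by blast
qed

lemma direction_involution [simp]: "- h (- h u) = u"
  by (simp add: linear_neg[OF linear_h] h_involution)

lemma periods_reverse: "periods (reverse \<gamma>) = periods \<gamma>"
proof -
  have *: "periods \<gamma> \<subseteq> periods (reverse \<gamma>)" for \<gamma>
  proof
    fix T assume T: "T \<in> periods \<gamma>"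
    have "\<gamma> (- (t + T)) = \<gamma> (- t)" for t
    proof -
      have "\<gamma> (- (t + T) + T) = \<gamma> (- (t + T))"
        using T unfolding periods_def by blast
      then show ?thesis
        by simp
    qed
    with T show "T \<in> periods (reverse \<gamma>)"
      by (simp only: periods_def reverse_def mem_Collect_eq simp_thms)
  qed
  show ?thesis
    using *[of \<gamma>] *[of "reverse \<gamma>"] by simp
qed

lemma periodic_trajectories_reverse:
  "periodic_trajectories S (- h u) = reverse ` periodic_trajectories S u"
proof -
  have *: "reverse \<gamma> \<in> periodic_trajectories S (- h u)" if "\<gamma> \<in> periodic_trajectories S u" for \<gamma> u
    using that by (simp add: periodic_trajectories_def trajectory_reverse periods_reverse)
  show ?thesis
  proof (intro equalityI subsetI)
    fix \<gamma> assume "\<gamma> \<in> periodic_trajectories S (- h u)"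
    from *[OF this] show "\<gamma> \<in> reverse ` periodic_trajectories S u"
      by (metis direction_involution image_eqI reverse_reverse)
  qed (auto intro: *)
qed

text \<open>The homeomorphism \<open>flip\<close> carries the region covered by the periodic
  trajectories of one direction onto that of the other, hence components onto components.\<close>

lemma cylinders_reverse: "cylinders S (- h u) = image flip ` cylinders S u"
proof -
  let ?U = "\<lambda>u. \<Union>\<gamma>\<in>periodic_trajectories S u. range \<gamma>"
  have U: "?U (- h u) = flip ` ?U u"
    by (simp add: periodic_trajectories_reverse range_reverse image_UN)
  have "flip ` topspace (surface_topology S) = topspace (surface_topology S)"
    by (rule homeomorphic_imp_surjective_map[OF homeomorphic_flip])
  then have "flip ` (topspace (surface_topology S) \<inter> ?U u) =
      topspace (surface_topology S) \<inter> ?U (- h u)"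
    by (simp only: image_Int[OF inj_flip] U)
  with homeomorphic_flip show ?thesis
    unfolding cylinders_def
    by (intro homeomorphic_map_connected_components_of homeomorphic_map_subtopologies)
qed

lemma trajectories_in_reverse:
  "trajectories_in S (- h u) (flip ` C) = reverse ` trajectories_in S u C"
proof -
  have "range (reverse \<gamma>) \<subseteq> flip ` C \<longleftrightarrow> range \<gamma> \<subseteq> C" for \<gamma>
    unfolding range_reverse by (rule inj_image_subset_iff[OF inj_flip])
  then show ?thesis
    by (simp only: trajectories_in_def periodic_trajectories_reverse Compr_image_eq)
qed

text \<open>Reversal preserves periods, so both \<open>THE\<close> terms range over the same
  condition on \<open>L\<close> and agree whatever it selects.\<close>

lemma cylinder_length_reverse:
  "cylinder_length S (- h u) (flip ` C) = cylinder_length S u C"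
  by (simp add: cylinder_length_def trajectories_in_reverse periods_reverse)

lemma flip_cylinder_eq: "flip ` C = flip ` C' \<longleftrightarrow> C = C'"
  by (metis flip_image_flip)

lemma short_cylinder_reverse: "short_cylinder S u C \<Longrightarrow> short_cylinder S (- h u) (flip ` C)"
  by (auto simp: short_cylinder_def cylinders_reverse cylinder_length_reverse flip_cylinder_eq)

lemma long_cylinder_reverse: "long_cylinder S u C \<Longrightarrow> long_cylinder S (- h u) (flip ` C)"
  by (auto simp: long_cylinder_def cylinders_reverse cylinder_length_reverse flip_cylinder_eq)

end

section \<open>Side reflections of the regular pentagon\<close>

text \<open>This is the reflection in the line through the origin at angle
  \<open>\<theta> / 2\<close>: it sends polar angle \<open>\<psi>\<close> to
  \<open>\<theta> - \<psi>\<close>.\<close>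

definition reflection :: "real \<Rightarrow> plane \<Rightarrow> plane" where
  "reflection \<theta> x = vector [cos \<theta> * x $ 1 + sin \<theta> * x $ 2, sin \<theta> * x $ 1 - cos \<theta> * x $ 2]"

lemma plane_eq_iff: "(x :: plane) = y \<longleftrightarrow> x $ 1 = y $ 1 \<and> x $ 2 = y $ 2"
  by (simp add: vec_eq_iff forall_2)

lemma linear_reflection: "linear (reflection \<theta>)"
  by (rule linearI) (simp_all add: reflection_def plane_eq_iff algebra_simps)

lemma reflection_involution: "reflection \<theta> (reflection \<theta> x) = x"
proof -
  \<comment> \<open>With \<open>c\<close> and \<open>s\<close> for cosine and sine, the claim
    becomes a polynomial identity on the unit circle.\<close>
  have "c * (c * a + s * b) + s * (s * a - c * b) = a" "s * (c * a + s * b) - c * (s * a - c * b) = b"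
    if "c\<^sup>2 + s\<^sup>2 = 1" for a b c s :: real
    using that by algebra+
  from this[OF cos_squared_eq[of \<theta>, THEN eq_diff_eq[THEN iffD1]]] show ?thesis
    by (simp add: reflection_def plane_eq_iff)
qed

lemma norm_reflection: "norm (reflection \<theta> x) = norm x"
proof -
  have "(c * a + s * b)\<^sup>2 + (s * a - c * b)\<^sup>2 = a\<^sup>2 + b\<^sup>2"
    if "c\<^sup>2 + s\<^sup>2 = 1" for a b c s :: real
    using that by algebra
  from this[OF cos_squared_eq[of \<theta>, THEN eq_diff_eq[THEN iffD1]]] show ?thesis
    by (simp add: reflection_def norm_vec_def L2_set_def sum_2)
qed

lemma reflection_polar:
  "reflection \<theta> (vector [r * cos \<psi>, r * sin \<psi>]) = vector [r * cos (\<theta> - \<psi>), r * sin (\<theta> - \<psi>)]"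
  by (simp add: reflection_def plane_eq_iff cos_diff sin_diff algebra_simps)

lemma cos_sin_turns:
  fixes x :: real
  shows "cos (x + real n * (2 * pi)) = cos x" "sin (x + real n * (2 * pi)) = sin x"
    and "cos (x - real n * (2 * pi)) = cos x" "sin (x - real n * (2 * pi)) = sin x"
  using cos.plus_of_nat[of x n] sin.plus_of_nat[of x n] cos.minus_of_nat[of x n] sin.minus_of_nat[of x n]
  by simp_all

lemma reflection_add_turns: "reflection (\<theta> + real n * (2 * pi)) = reflection \<theta>"
  by (simp add: reflection_def fun_eq_iff cos_sin_turns)

section \<open>The pentagon in polar coordinates and its side reflections\<close>

definition pentagon :: "real \<Rightarrow> real \<Rightarrow> nat \<Rightarrow> plane" where
  "pentagon r \<alpha> j =
    vector [r * cos (\<alpha> + 2 * pi * real j / 5), r * sin (\<alpha> + 2 * pi * real j / 5)]"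

lemma pentagon_add_5: "pentagon r \<alpha> (j + 5 * n) = pentagon r \<alpha> j"
proof -
  have *: "\<alpha> + 2 * pi * real (j + 5 * n) / 5 = (\<alpha> + 2 * pi * real j / 5) + real n * (2 * pi)"
    by (simp add: field_simps)
  show ?thesis
    unfolding pentagon_def * cos_sin_turns ..
qed

lemma pentagon_mod: "pentagon r \<alpha> (j mod 5) = pentagon r \<alpha> j"
  by (metis add.commute mod_mult_div_eq pentagon_add_5)

lemma pentagon_Suc_mod: "pentagon r \<alpha> (Suc (j mod 5)) = pentagon r \<alpha> (Suc j)"
  by (metis mod_Suc_eq pentagon_mod)

text \<open>The angle \<open>\<mu>\<close> is that of the midpoint of side \<open>m\<close>. The
  side is perpendicular to it and has length \<open>2 * r * sin (pi / 5)\<close> for positive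
  \<open>r\<close>.\<close>

lemma pentagon_edge:
  fixes \<alpha> :: real and m :: nat
  defines "\<mu> \<equiv> \<alpha> + 2 * pi * real m / 5 + pi / 5"
  shows "pentagon r \<alpha> (Suc m) - pentagon r \<alpha> m =
    vector [2 * r * sin (pi / 5) * - sin \<mu>, 2 * r * sin (pi / 5) * cos \<mu>]"
proof -
  have *: "\<alpha> + 2 * pi * real (Suc m) / 5 = \<mu> + pi / 5" "\<alpha> + 2 * pi * real m / 5 = \<mu> - pi / 5"
    by (simp_all add: \<mu>_def field_simps)
  show ?thesis
    unfolding pentagon_def *
    by (simp add: plane_eq_iff cos_add cos_diff sin_add sin_diff algebra_simps)
qed

lemma sin_pi_div_5_pos: "sin (pi / 5) > 0"
  by (rule sin_gt_zero) (simp_all add: field_simps)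

text \<open>The side \<open>m\<close> has direction \<open>\<alpha> + 2\<pi>m/5 + \<pi>/5 + \<pi>/2\<close>; a reflection doubles this angle.\<close>

definition side_angle :: "real \<Rightarrow> nat \<Rightarrow> real" where
  "side_angle \<alpha> m = 2 * (\<alpha> + 2 * pi * real m / 5 + pi / 5) + pi"

lemma side_reflection_pentagon:
  assumes "r > 0"
  shows "side_reflection (pentagon r \<alpha>) m = reflection (side_angle \<alpha> m)"
proof
  fix x :: plane
  define \<mu> where "\<mu> = \<alpha> + 2 * pi * real m / 5 + pi / 5"
  define c where "c = 2 * r * sin (pi / 5)"
  have c: "c \<noteq> 0"
    using assms sin_pi_div_5_pos by (simp add: c_def)
  define e :: plane where "e = vector [c * - sin \<mu>, c * cos \<mu>]"
  have e: "pentagon r \<alpha> (Suc m) - pentagon r \<alpha> m = e"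
    unfolding e_def c_def \<mu>_def by (rule pentagon_edge)
  have "e \<bullet> e = (c * sin \<mu>)\<^sup>2 + (c * cos \<mu>)\<^sup>2"
    by (simp add: e_def inner_vec_def sum_2 power2_eq_square)
  also have "\<dots> = c\<^sup>2"
    by (simp add: power_mult_distrib flip: distrib_left)
  finally have ee: "e \<bullet> e = c\<^sup>2" .
  have xe: "x \<bullet> e = c * (x $ 2 * cos \<mu> - x $ 1 * sin \<mu>)"
    by (simp add: e_def inner_vec_def sum_2 algebra_simps)
  \<comment> \<open>The length \<open>c\<close> of the side cancels; \<open>d\<close> stands for
    either coordinate of its unit direction.\<close>
  have scal: "2 * (x \<bullet> e) / (e \<bullet> e) * (c * d) = 2 * (x $ 2 * cos \<mu> - x $ 1 * sin \<mu>) * d" for d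
    unfolding ee xe using c by (simp add: power2_eq_square)
  \<comment> \<open>The projection onto the side produces a squared sine in the first coordinate and
    a squared cosine in the second, so both forms are used.\<close>
  have angle: "cos (side_angle \<alpha> m) = 2 * (sin \<mu>)\<^sup>2 - 1" "cos (side_angle \<alpha> m) = 1 - 2 * (cos \<mu>)\<^sup>2"
    "sin (side_angle \<alpha> m) = - 2 * sin \<mu> * cos \<mu>"
    unfolding side_angle_def \<mu>_def[symmetric]
    by (simp add: cos_double_sin, simp add: cos_double_cos, simp add: sin_double)
  have "side_reflection (pentagon r \<alpha>) m x $ 1 = 2 * (x \<bullet> e) / (e \<bullet> e) * (c * - sin \<mu>) - x $ 1"
    by (simp add: side_reflection_def Let_def e) (simp add: e_def)
  also have "\<dots> = reflection (side_angle \<alpha> m) x $ 1"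
    unfolding scal by (simp add: reflection_def angle(1,3) algebra_simps power2_eq_square)
  finally have 1: "side_reflection (pentagon r \<alpha>) m x $ 1 = \<dots>" .
  have "side_reflection (pentagon r \<alpha>) m x $ 2 = 2 * (x \<bullet> e) / (e \<bullet> e) * (c * cos \<mu>) - x $ 2"
    by (simp add: side_reflection_def Let_def e) (simp add: e_def)
  also have "\<dots> = reflection (side_angle \<alpha> m) x $ 2"
    unfolding scal by (simp add: reflection_def angle(2,3) algebra_simps power2_eq_square)
  finally have 2: "side_reflection (pentagon r \<alpha>) m x $ 2 = \<dots>" .
  from 1 2 show "side_reflection (pentagon r \<alpha>) m x = reflection (side_angle \<alpha> m) x"
    by (simp add: plane_eq_iff)
qed

text \<open>The summand \<open>4 * j\<close> stands for \<open>- j\<close> modulo \<open>5\<close>.\<close>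

lemma reflection_pentagon:
  "reflection (side_angle \<alpha> m) (pentagon r \<alpha> j) = - pentagon r \<alpha> (2 * m + 1 + 4 * j)"
proof -
  let ?\<psi> = "\<alpha> + 2 * pi * real (2 * m + 1 + 4 * j) / 5"
  have *: "side_angle \<alpha> m - (\<alpha> + 2 * pi * real j / 5) = (?\<psi> - real j * (2 * pi)) + pi"
    by (simp add: side_angle_def field_simps)
  show ?thesis
    unfolding pentagon_def reflection_polar * cos_periodic_pi sin_periodic_pi cos_sin_turns
    by (simp add: plane_eq_iff)
qed

text \<open>This is why the reflection exchanges the two tiles of the double pentagon. One inclusion
  reduces indices modulo 5; the other follows by the involution property.\<close>

lemma reflection_pentagon_vertices:
  "reflection (side_angle \<alpha> m) ` pentagon r \<alpha> ` {..<5} = uminus ` pentagon r \<alpha> ` {..<5}"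
proof -
  let ?h = "reflection (side_angle \<alpha> m)"
  have *: "?h (pentagon r \<alpha> j) \<in> uminus ` pentagon r \<alpha> ` {..<5}" for j
  proof -
    have "?h (pentagon r \<alpha> j) = - pentagon r \<alpha> ((2 * m + 1 + 4 * j) mod 5)"
      by (simp only: reflection_pentagon pentagon_mod)
    then show ?thesis
      by simp
  qed
  have "- pentagon r \<alpha> j \<in> ?h ` pentagon r \<alpha> ` {..<5}" for j
  proof -
    obtain k where "k < 5" "?h (pentagon r \<alpha> j) = - pentagon r \<alpha> k"
      using *[of j] by auto
    then have "- pentagon r \<alpha> j = ?h (pentagon r \<alpha> k)"
      by (metis reflection_involution linear_neg[OF linear_reflection] minus_minus)
    then show ?thesis
      using \<open>k < 5\<close> by auto
  qed
  then show ?thesis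
    using * by auto
qed

lemma side_pentagon_mod: "side (\<lambda>i. c *\<^sub>R pentagon r \<alpha> i) (j mod 5) = side (\<lambda>i. c *\<^sub>R pentagon r \<alpha> i) j"
  by (simp add: side_def pentagon_mod pentagon_Suc_mod)

lemma side_linear_image: "linear f \<Longrightarrow> side (\<lambda>i. f (q i)) j = f ` side q j"
  by (simp add: side_def closed_segment_linear_image)

text \<open>The endpoints \<open>j\<close> and \<open>Suc j\<close> go to indices
  \<open>2 * m + 4 * j + 1\<close> and \<open>2 * m + 4 * j + 5\<close>. The latter is
  \<open>2 * m + 4 * j\<close> modulo 5, so the side is traversed backwards.\<close>

lemma reflection_pentagon_side:
  "reflection (side_angle \<alpha> m) ` side (\<lambda>i. c *\<^sub>R pentagon r \<alpha> i) j =
    side (\<lambda>i. - c *\<^sub>R pentagon r \<alpha> i) ((2 * m + 4 * j) mod 5)"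
proof -
  have "reflection (side_angle \<alpha> m) (c *\<^sub>R pentagon r \<alpha> j) =
      - c *\<^sub>R pentagon r \<alpha> (Suc (2 * m + 4 * j))"
    by (simp add: linear_scale[OF linear_reflection] reflection_pentagon)
  moreover have "reflection (side_angle \<alpha> m) (c *\<^sub>R pentagon r \<alpha> (Suc j)) =
      - c *\<^sub>R pentagon r \<alpha> (2 * m + 4 * j)"
    using pentagon_add_5[of r \<alpha> "2 * m + 4 * j" 1]
    by (simp add: linear_scale[OF linear_reflection] reflection_pentagon algebra_simps)
  ultimately show ?thesis
    unfolding side_pentagon_mod
    by (simp add: side_linear_image[OF linear_reflection, symmetric])
      (simp add: side_def closed_segment_commute)
qed

section \<open>Action on the double pentagon and the necklace\<close>

lemma double_pentagon_involution:
  "surface_involution (double_pentagon (pentagon r \<alpha>)) uminus (reflection (side_angle \<alpha> m))"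
proof (rule surface_involution.intro)
  let ?S = "double_pentagon (pentagon r \<alpha>)" and ?h = "reflection (side_angle \<alpha> m)"
  show "vertex ?S (- a) ` {..<5} = ?h ` vertex ?S a ` {..<5}" for a :: real
  proof -
    have "?h ` vertex ?S a ` {..<5} = (*\<^sub>R) a ` ?h ` pentagon r \<alpha> ` {..<5}"
      by (simp add: double_pentagon_def image_image linear_scale[OF linear_reflection])
    also have "\<dots> = (*\<^sub>R) a ` uminus ` pentagon r \<alpha> ` {..<5}"
      by (simp only: reflection_pentagon_vertices)
    also have "\<dots> = vertex ?S (- a) ` {..<5}"
      by (simp add: double_pentagon_def image_image)
    finally show ?thesis
      by simp
  qed
  show "\<exists>k<5. side (vertex ?S (- a)) k = ?h ` side (vertex ?S a) j \<and>
      neighbour ?S (- a) k = - neighbour ?S a j" for a j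
    by (intro exI[of _ "(2 * m + 4 * j) mod 5"])
      (simp add: double_pentagon_def reflection_pentagon_side)
qed (auto simp: double_pentagon_def linear_reflection reflection_involution)

text \<open>The group is generated by multiplication on the right, whereas the symmetry of the
  necklace multiplies labels on the left; associativity reconciles the two.\<close>

lemma dihedral_compose_left:
  "g \<in> dihedral q \<Longrightarrow> j < 5 \<Longrightarrow> side_reflection q j \<circ> g \<in> dihedral q"
proof (induction rule: dihedral.induct)
  case id
  then show ?case
    using dihedral.step[OF dihedral.id] by simp
next
  case (step g i)
  then show ?case
    using dihedral.step[OF step.IH[OF step.prems] step.hyps(2)] by (simp only: comp_assoc)
qed

text \<open>Gluing multiplies labels on the right and so commutes with \<open>h\<close> on the left.
  Vertices of a copy keep the numbering of \<open>Q\<close>, whence sides keep their index.\<close>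

lemma necklace_involution:
  assumes "r > 0" and "m < 5"
  shows "surface_involution (necklace (pentagon r \<alpha>)) ((\<circ>) (reflection (side_angle \<alpha> m)))
    (reflection (side_angle \<alpha> m))"
proof (rule surface_involution.intro)
  let ?q = "pentagon r \<alpha>" and ?h = "reflection (side_angle \<alpha> m)"
  let ?S = "necklace ?q"
  show "?h \<circ> (?h \<circ> g) = g" for g :: "plane \<Rightarrow> plane"
    by (simp add: fun_eq_iff reflection_involution)
  show "?h \<circ> g \<in> labels ?S" if "g \<in> labels ?S" for g
    using that dihedral_compose_left[of g ?q m] assms
    by (simp add: necklace_def side_reflection_pentagon)
  show "linear ?h"
    by (rule linear_reflection)
  show "\<exists>k<5. side (vertex ?S (?h \<circ> g)) k = ?h ` side (vertex ?S g) j \<and>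
      neighbour ?S (?h \<circ> g) k = ?h \<circ> neighbour ?S g j" if "j < 5" for g j
    using that
    by (intro exI[of _ j])
      (simp add: necklace_def side_linear_image[OF linear_reflection] comp_assoc)
qed (simp_all add: necklace_def reflection_involution image_image)

section \<open>Compatibility of the involutions with covering, lifts and folding\<close>

locale pentagon_side =
  fixes r \<alpha> :: real and m :: nat
  assumes r_pos: "r > 0" and m_less: "m < 5"
begin

abbreviation "Q \<equiv> pentagon r \<alpha>"
abbreviation "h \<equiv> reflection (side_angle \<alpha> m)"

sublocale double: surface_involution "double_pentagon Q" uminus h
  by (rule double_pentagon_involution)

sublocale necklace: surface_involution "necklace Q" "(\<circ>) h" h
  using r_pos m_less by (rule necklace_involution)

lemma reflection_polygon: "h ` polygon Q = uminus ` polygon Q"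
  by (simp add: polygon_def convex_hull_linear_image linear_reflection reflection_pentagon_vertices
      linear_uminus)

text \<open>Apply \<open>h\<close> to both sides: it is an involution, commutes with scaling, and
  sends \<open>Q\<close> to \<open>-Q\<close>.\<close>

lemma polygon_flip:
  "(h \<circ> g) ` polygon Q = (*\<^sub>R) \<delta> ` polygon Q \<longleftrightarrow> g ` polygon Q = (*\<^sub>R) (- \<delta>) ` polygon Q"
proof -
  have "h ` (*\<^sub>R) \<delta> ` polygon Q = (*\<^sub>R) \<delta> ` h ` polygon Q"
    by (simp add: image_image linear_scale[OF linear_reflection])
  also have "\<dots> = (*\<^sub>R) (- \<delta>) ` polygon Q"
    by (simp add: reflection_polygon image_image)
  finally have *: "h ` (*\<^sub>R) \<delta> ` polygon Q = (*\<^sub>R) (- \<delta>) ` polygon Q" .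
  have "h ` h ` A = A" for A
    by (simp add: image_image reflection_involution)
  then have "h ` A = B \<longleftrightarrow> A = h ` B" for A B
    by metis
  from this[of "g ` polygon Q" "(*\<^sub>R) \<delta> ` polygon Q"] show ?thesis
    by (simp only: image_comp[symmetric] *)
qed

text \<open>Replacing \<open>g\<close> by \<open>h \<circ> g\<close> reindexes the copies and
  changes the sign of the pentagon that each one equals.\<close>

lemma covering_flip: "covering Q (necklace.flip p) = double.flip (covering Q p)"
proof (rule set_eqI, clarify)
  fix \<delta> :: real and x
  have "(\<exists>g. (h \<circ> g, h x) \<in> p \<and> g ` polygon Q = (*\<^sub>R) \<delta> ` polygon Q) \<longleftrightarrow>
      (\<exists>g. (g, h x) \<in> p \<and> g ` polygon Q = (*\<^sub>R) (- \<delta>) ` polygon Q)"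
    (is "?L \<longleftrightarrow> ?R")
  proof
    assume ?L
    then obtain g where "(h \<circ> g, h x) \<in> p" "(h \<circ> g) ` polygon Q = (*\<^sub>R) (- \<delta>) ` polygon Q"
      unfolding polygon_flip minus_minus by blast
    then show ?R
      by blast
  next
    assume ?R
    then obtain g where "(h \<circ> (h \<circ> g), h x) \<in> p" "(h \<circ> g) ` polygon Q = (*\<^sub>R) \<delta> ` polygon Q"
      unfolding polygon_flip necklace.label_involution by blast
    then show ?L
      by blast
  qed
  then show "(\<delta>, x) \<in> covering Q (necklace.flip p) \<longleftrightarrow> (\<delta>, x) \<in> double.flip (covering Q p)"
    by (simp add: covering_def necklace.mem_flip double.mem_flip minus_equation_iff[of \<delta>] disj_commute)
qed

lemma lifts_reverse:
  assumes "\<eta> \<in> lifts Q u \<gamma>"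
  shows "necklace.reverse \<eta> \<in> lifts Q (- h u) (double.reverse \<gamma>)"
proof -
  have "trajectory (necklace Q) (- h u) (necklace.reverse \<eta>)"
    using assms by (intro necklace.trajectory_reverse) (simp add: lifts_def)
  moreover have "covering Q (necklace.reverse \<eta> t) = double.reverse \<gamma> t" for t
    using assms by (simp add: lifts_def necklace.reverse_def double.reverse_def covering_flip)
  ultimately show ?thesis
    by (simp add: lifts_def)
qed

text \<open>A point \<open>g x\<close> of copy \<open>g\<close> moves to \<open>h (g x)\<close> in
  copy \<open>h \<circ> g\<close>, which folds to the same \<open>x\<close>.\<close>

lemma folding_flip: "folding (necklace.flip p) = folding p"
proof -
  have "(\<exists>g. (h \<circ> g, h (g x)) \<in> p) \<longleftrightarrow> (\<exists>g. (g, g x) \<in> p)" (is "?L \<longleftrightarrow> ?R") for x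
  proof
    assume ?L
    then obtain g where "(h \<circ> g, (h \<circ> g) x) \<in> p"
      by auto
    then show ?R
      by blast
  next
    assume ?R
    then obtain g where "(h \<circ> (h \<circ> g), h ((h \<circ> g) x)) \<in> p"
      by (auto simp only: necklace.label_involution comp_apply reflection_involution)
    then show ?L
      by blast
  qed
  then show ?thesis
    by (simp only: folding_def necklace.mem_flip)
qed

text \<open>Substituting \<open>- c\<close> for \<open>c\<close> exchanges the two orientations, so
  the reversal of time disappears once paths are unoriented.\<close>

lemma unoriented_path_reverse:
  "unoriented_path (\<lambda>t. folding (necklace.reverse \<eta> t)) = unoriented_path (\<lambda>t. folding (\<eta> t))"
proof -
  have "unoriented_path (\<lambda>t. \<beta> (- t)) = unoriented_path \<beta>" for \<beta> :: "real \<Rightarrow> plane"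
  proof -
    have *: "unoriented_path (\<lambda>t. \<beta> (- t)) \<subseteq> unoriented_path \<beta>" for \<beta> :: "real \<Rightarrow> plane"
    proof
      fix \<pi> assume "\<pi> \<in> unoriented_path (\<lambda>t. \<beta> (- t))"
      then obtain c where "\<pi> = (\<lambda>t. \<beta> (- (c + t))) \<or> \<pi> = (\<lambda>t. \<beta> (- (c - t)))"
        by (auto simp: unoriented_path_def)
      then have "\<pi> = (\<lambda>t. \<beta> (- c - t)) \<or> \<pi> = (\<lambda>t. \<beta> (- c + t))"
        by simp
      then show "\<pi> \<in> unoriented_path \<beta>"
        unfolding unoriented_path_def by blast
    qed
    show ?thesis
      using *[of \<beta>] *[of "\<lambda>t. \<beta> (- t)"] by auto
  qed
  from this[of "\<lambda>t. folding (\<eta> t)"] show ?thesis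
    by (simp add: necklace.reverse_def folding_flip)
qed

text \<open>The predicate \<open>K\<close> is a parameter so that short and long cylinders are
  treated at once. An inclusion for every \<open>u\<close> suffices, as \<open>- h\<close> is an
  involution.\<close>

lemma billiard_trajectories_reverse:
  assumes K: "\<And>u C. K (double_pentagon Q) u C \<Longrightarrow> K (double_pentagon Q) (- h u) (double.flip ` C)"
  defines "B \<equiv> \<lambda>u. {unoriented_path (\<lambda>t. folding (\<eta> t)) | \<eta> \<gamma> C. K (double_pentagon Q) u C \<and>
     \<gamma> \<in> trajectories_in (double_pentagon Q) u C \<and> \<eta> \<in> lifts Q u \<gamma>}"
  shows "B (- h u) = B u"
proof -
  have *: "B u \<subseteq> B (- h u)" for u
  proof
    fix \<pi> assume "\<pi> \<in> B u"
    then obtain \<eta> \<gamma> C where "K (double_pentagon Q) u C"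
      "\<gamma> \<in> trajectories_in (double_pentagon Q) u C" "\<eta> \<in> lifts Q u \<gamma>"
      and \<pi>: "\<pi> = unoriented_path (\<lambda>t. folding (\<eta> t))"
      by (auto simp: B_def)
    then have "K (double_pentagon Q) (- h u) (double.flip ` C)"
      "double.reverse \<gamma> \<in> trajectories_in (double_pentagon Q) (- h u) (double.flip ` C)"
      "necklace.reverse \<eta> \<in> lifts Q (- h u) (double.reverse \<gamma>)"
      using K double.trajectories_in_reverse lifts_reverse by auto
    then show "\<pi> \<in> B (- h u)"
      unfolding B_def \<pi> unoriented_path_reverse[of \<eta>, symmetric] by blast
  qed
  show ?thesis
    using *[of u] *[of "- h u"] by (simp add: double.direction_involution)
qed

end

section \<open>The directions of the two words\<close>

definition coordinate_swap :: "plane \<Rightarrow> plane" where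
  "coordinate_swap v = vector [v $ 2, v $ 1]"

lemma sigma_swap:
  "k \<in> {0, 1, 2, 3} \<Longrightarrow>
    sigma ((id(0 := 3, 3 := 0, 1 := 2, 2 := 1)) k) *v coordinate_swap v =
      coordinate_swap (sigma k *v v)"
  by (auto simp: sigma_def coordinate_swap_def plane_eq_iff matrix_vector_mult_def sum_2)

lemma foldl_sigma_swap:
  "set w \<subseteq> {0, 1, 2, 3} \<Longrightarrow>
    foldl (\<lambda>v k. sigma k *v v) (coordinate_swap v) (map (id(0 := 3, 3 := 0, 1 := 2, 2 := 1)) w) =
      coordinate_swap (foldl (\<lambda>v k. sigma k *v v) v w)"
proof (induction w arbitrary: v)
  case (Cons k w)
  have k: "k \<in> {0, 1, 2, 3}" and w: "set w \<subseteq> {0, 1, 2, 3}"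
    using Cons.prems by simp_all
  show ?case
    by (simp only: list.map foldl.simps sigma_swap[OF k] Cons.IH[OF w])
qed simp

lemma tree_vector_swapped_word:
  assumes "tree_word w"
  shows "tree_vector (swapped_word w) = coordinate_swap (tree_vector w)"
proof -
  obtain k w' where w: "w = k # w'" and k: "k \<in> {1, 2, 3}" and w': "set w' \<subseteq> {0, 1, 2, 3}"
    using assms by (cases w) (auto simp: tree_word_def)
  \<comment> \<open>The start vector is not fixed by the coordinate swap, hence the separate rule
    for the first digit: digits 1, 2, 3 give the vectors \<open>(golden, 1)\<close>,
    \<open>(golden, golden)\<close>, \<open>(1, golden)\<close>.\<close>
  have "sigma ((id(1 := 3, 3 := 1)) k) *v vector [1, 0] =
      coordinate_swap (sigma k *v vector [1, 0])"
    using k by (auto simp: sigma_def coordinate_swap_def plane_eq_iff matrix_vector_mult_def sum_2)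
  then show ?thesis
    by (simp only: w tree_vector_def swapped_word_def list.sel foldl.simps foldl_sigma_swap[OF w'])
qed

text \<open>The columns of \<open>Pmat\<close> are the unit vectors at angles 0 and
  \<open>pi / 5\<close>. Their exchange is the reflection in the axis at \<open>pi / 10\<close>, the
  negative of that in the perpendicular axis at \<open>3 * pi / 5\<close>.\<close>

lemma Pmat_coordinate_swap:
  "Pmat *v coordinate_swap v = - reflection (6 * pi / 5) (Pmat *v v)"
proof -
  have "6 * pi / 5 = pi / 5 + pi"
    by (simp add: field_simps)
  then have *: "cos (6 * pi / 5) = - cos (pi / 5)" "sin (6 * pi / 5) = - sin (pi / 5)"
    by (simp_all only: cos_periodic_pi sin_periodic_pi)
  have "c * (a + c * b) + s * (s * b) = b + c * a" "s * (a + c * b) - c * (s * b) = s * a"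
    if "c\<^sup>2 + s\<^sup>2 = 1" for a b c s :: real
    using that by (algebra, simp add: algebra_simps)
  from this[OF cos_squared_eq[of "pi / 5", THEN eq_diff_eq[THEN iffD1]]] show ?thesis
    unfolding reflection_def *
    by (simp add: Pmat_def coordinate_swap_def plane_eq_iff matrix_vector_mult_def sum_2 algebra_simps)
qed

lemma tree_direction_swapped_word:
  assumes "tree_word w"
  shows "tree_direction (swapped_word w) = - reflection (6 * pi / 5) (tree_direction w)"
  by (simp add: tree_direction_def tree_vector_swapped_word[OF assms] Pmat_coordinate_swap
      sgn_div_norm norm_reflection linear_scale[OF linear_reflection])

text \<open>The side with direction \<open>3\<pi>/5\<close> is the predecessor of the horizontal side.\<close>

lemma horizontal_side_reflection:
  assumes "r > 0" and "pentagon r \<alpha> j $ 2 = pentagon r \<alpha> (Suc j) $ 2"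
  shows "reflection (side_angle \<alpha> ((j + 4) mod 5)) = reflection (6 * pi / 5)"
proof -
  define \<mu> where "\<mu> = \<alpha> + 2 * pi * real j / 5 + pi / 5"
  have "(pentagon r \<alpha> (Suc j) - pentagon r \<alpha> j) $ 2 = 0"
    using assms by simp
  then have "cos \<mu> = 0"
    unfolding pentagon_edge \<mu>_def using assms sin_pi_div_5_pos by simp
  \<comment> \<open>Since \<open>\<mu>\<close> is an odd multiple of \<open>pi / 2\<close>, this
    angle is a whole number of turns.\<close>
  then have *: "cos (2 * \<mu> + pi) = 1" "sin (2 * \<mu> + pi) = 0"
    by (simp_all add: cos_double_cos sin_double)
  define n where "n = (j + 4) div 5"
  have "j + 4 = (j + 4) mod 5 + 5 * n"
    by (simp add: n_def)
  then have "real j + 4 = real ((j + 4) mod 5) + 5 * real n"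
    by (metis of_nat_add of_nat_mult of_nat_numeral)
  then have j: "real ((j + 4) mod 5) = real j + 4 - 5 * real n"
    by simp
  \<comment> \<open>Advancing by four sides adds \<open>16 * pi / 5\<close>, that is
    \<open>6 * pi / 5\<close> and one turn; each reduction of the index by 5 removes two
    turns.\<close>
  have "side_angle \<alpha> ((j + 4) mod 5) + real (2 * n) * (2 * pi) =
      (2 * \<mu> + pi) + 6 * pi / 5 + real 1 * (2 * pi)"
    unfolding side_angle_def \<mu>_def j by (simp add: field_simps)
  from this[THEN arg_cong[where f = reflection]]
  have "reflection (side_angle \<alpha> ((j + 4) mod 5)) = reflection ((2 * \<mu> + pi) + 6 * pi / 5)"
    unfolding reflection_add_turns .
  also have "\<dots> = reflection (6 * pi / 5)"
    unfolding reflection_def cos_add[of "2 * \<mu> + pi"] sin_add[of "2 * \<mu> + pi"] * by simp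
  finally show ?thesis .
qed

theorem theorem2p16:
  fixes q :: "nat \<Rightarrow> real^2" and w :: "nat list"
  assumes "regular_pentagon_at_origin q"
    and "\<exists>j. (q j) $ 2 = (q (Suc j)) $ 2"
    and "\<And>j. dist (q j) (q (j + 2)) = 1"
    and "tree_word w"
  shows "short_billiard_trajectories q w = short_billiard_trajectories q (swapped_word w)
    \<and> long_billiard_trajectories q w = long_billiard_trajectories q (swapped_word w)"
proof -
  obtain r \<alpha> where r: "r > 0" and q: "q = pentagon r \<alpha>"
    using assms(1) by (auto simp: regular_pentagon_at_origin_def pentagon_def fun_eq_iff)
  obtain j where j: "pentagon r \<alpha> j $ 2 = pentagon r \<alpha> (Suc j) $ 2"
    using assms(2) q by blast
  \<comment> \<open>The index \<open>j\<close> of the horizontal side may be any natural number; its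
    predecessor is taken modulo 5 to index a generator of the dihedral group.\<close>
  interpret pentagon_side r \<alpha> "(j + 4) mod 5"
    using r by unfold_locales simp_all
  have u: "tree_direction (swapped_word w) = - h (tree_direction w)"
    using tree_direction_swapped_word[OF assms(4)] horizontal_side_reflection[OF r j] by simp
  show ?thesis
    unfolding q short_billiard_trajectories_def long_billiard_trajectories_def u
    using billiard_trajectories_reverse[of short_cylinder, OF double.short_cylinder_reverse]
      billiard_trajectories_reverse[of long_cylinder, OF double.long_cylinder_reverse]
    by simp
qed

end
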